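(* Suppose that the linear second-stage problem (LP2) is feasible for all $x_{T_1}$ that are feasible for the first-stage problem (NLP1). Suppose further that steps 1 and 6 of the split-horizon DDP algorithm return feasible solutions of (NLP1), and that step 2 solves (LP2) to optimality. Then the split-horizon DDP algorithm terminates in a finite number of iterations, returning a feasible solution of the split-horizon problem (TS). In addition: (a) If the nonconvex first stage is solved in step 6 to local optimality, then the returned solution is locally optimal for the two-stage problem (TS). (b) If the nonconvex first stage is solved in step 6 to global optimality, then the returned solution is globally optimal for the two-stage problem (TS).
   Context: Fix integers $0<T_1<T$, an initial state $x_0$, (general nonlinear) functions $f_t,g_t$ and sets $\mathcal Z_t$ for $t=0,\dots,T_1-1$, and vectors and matrices $c_t,d_t,A_t,B_t,E_t,F_t,h_t$ for $t=T_1,\dots,T-1$ and $c_T$, of compatible dimensions (states and inputs are finite-dimensional real vectors). **Two-stage (split-horizon) problem (TS).** Minimize $$\sum_{t=0}^{T_1-1} g_t(x_t,u_t)+\sum_{t=T_1}^{T-1}(c_t^\top\tilde x_t+d_t^\top\tilde u_t)+c_T^\top\tilde x_T$$ over $x_1,\dots,x_{T_1}$, $u_0,\dots,u_{T_1-1}$, $\tilde x_{T_1+1},\dots,\tilde x_T$, $\tilde u_{T_1},\dots,\tilde u_{T-1}$, subject to $x_{t+1}=f_t(x_t,u_t)$ and $(x_t,u_t)\in\mathcal Z_t$ for $t=0,\dots,T_1-1$; $\tilde x_{t+1}=A_t\tilde x_t+B_t\tilde u_t$ and $E_t\tilde x_t+F_t\tilde u_t\le h_t$ for $t=T_1,\dots,T-1$;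 $\tilde x_{T_1}=x_{T_1}$; $x_0$ given. (TS) is assumed feasible. **Second-stage problem (LP2)** for given $x_{T_1}$: $$\tilde G_{T_1}(x_{T_1})=\min_{\tilde x_{T_1+1},\dots,\tilde x_T,\ \tilde u_{T_1},\dots,\tilde u_{T-1}}\ \sum_{t=T_1}^{T-1}(c_t^\top\tilde x_t+d_t^\top\tilde u_t)+c_T^\top\tilde x_T$$ subject to $\tilde x_{t+1}=A_t\tilde x_t+B_t\tilde u_t$ and $E_t\tilde x_t+F_t\tilde u_t\le h_t$ for $t=T_1,\dots,T-1$, with $\tilde x_{T_1}=x_{T_1}$ given. **First-stage problem (NLP1).** Minimize $\sum_{t=0}^{T_1-1}g_t(x_t,u_t)+\tilde G_{T_1}(x_{T_1})$ over $x_1,\dots,x_{T_1},u_0,\dots,u_{T_1-1}$ subject to $x_{t+1}=f_t(x_t,u_t)$, $(x_t,u_t)\in\mathcal Z_t$ for $t=0,\dots,T_1-1$, $x_0$ given. **Split-horizon DDP algorithm.** Initialize $\mathcal H=\emptyset$, $UB=+\infty$, $LB=-\infty$. 1. Solve (NLP1) with $\tilde G_{T_1}(x_{T_1})$ replaced by $0$, obtaining a feasible solution $(u_0,\dots,u_{T_1-1}),(x_1,\dots,x_{T_1})$ of (NLP1). Then repeat steps 2–7: 2. Solve (LP2) at the $x_{T_1}$ found in the previous step, obtaining $(\tilde u_{T_1},\dots,\tilde u_{T-1})$ and $(\tilde x_{T_1+1},\dots,\tilde x_T)$. Let $\lambda$ and $\nu$ be the dual variables corresponding to the equality constraint $\tilde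 x_{t+1}=A_t\tilde x_t+B_t\tilde u_t$ and the inequality constraint $E_t\tilde x_t+F_t\tilde u_t\le h_t$, respectively, at $t=T_1$. 3. Set $UB=\sum_{t=T_1}^{T-1}(c_t^\top\tilde x_t+d_t^\top\tilde u_t)+c_T^\top\tilde x_T$. 4. If $UB=LB$, stop. 5. Let $a=A_{T_1}^\top\lambda+E_{T_1}^\top\nu+c_{T_1}$ and $b=-\nu^\top h_{T_1}$; replace $\mathcal H$ by $\mathcal H\cup\{(a,b)\}$. 6. Solve (NLP1) with $\tilde G_{T_1}(x_{T_1})$ replaced by $\underline G_{T_1}(x_{T_1})=\max_{(a,b)\in\mathcal H}(a^\top x_{T_1}+b)$, obtaining a feasible solution $(u_0,\dots,u_{T_1-1}),(x_1,\dots,x_{T_1})$ of (NLP1). 7. Set $LB=\underline G_{T_1}(x_{T_1})$. Output upon stopping: $u_{\text{full}}=(u_0,\dots,u_{T_1-1},\tilde u_{T_1},\dots,\tilde u_{T-1})$ and $x_{\text{full}}=(x_1,\dots,x_{T_1},\tilde x_{T_1+1},\dots,\tilde x_T)$.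
   Formalization: In step 5 the cut intercept is b = -(sum over t = T_1,...,T-1 of nu_t^T h_t), with the inequality multipliers of all second-stage times, instead of b = -nu^T h_{T_1}; with the latter the algorithm may never stop when T > T_1+1. *)

theory Defs
  imports "HOL-Library.Extended_Real" "Jordan_Normal_Form.Matrix"
begin

text \<open>
  All dimensions may vary with the stage: \<open>xdim t\<close> for states, \<open>udim t\<close> for inputs, \<open>cdim t\<close> for the
  inequality rows. Only the entries \<open>dyn t\<close>, \<open>gcost t\<close>, \<open>Zset t\<close> with \<open>t < T1\<close>, the entries \<open>dvec t\<close>,
  \<open>Amat t\<close>, \<open>Bmat t\<close>, \<open>Emat t\<close>, \<open>Fmat t\<close>, \<open>hvec t\<close> with \<open>T1 \<le> t < Tend\<close>, and \<open>cvec t\<close> with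
  \<open>T1 \<le> t \<le> Tend\<close> are relevant.
\<close>

record split_problem =
  T1 :: nat
  Tend :: nat
  xdim :: "nat \<Rightarrow> nat"
  udim :: "nat \<Rightarrow> nat"
  cdim :: "nat \<Rightarrow> nat"
  xinit :: "real vec"
  dyn :: "nat \<Rightarrow> real vec \<Rightarrow> real vec \<Rightarrow> real vec"
  gcost :: "nat \<Rightarrow> real vec \<Rightarrow> real vec \<Rightarrow> real"
  Zset :: "nat \<Rightarrow> (real vec \<times> real vec) set"
  cvec :: "nat \<Rightarrow> real vec"
  dvec :: "nat \<Rightarrow> real vec"
  Amat :: "nat \<Rightarrow> real mat"
  Bmat :: "nat \<Rightarrow> real mat"
  Emat :: "nat \<Rightarrow> real mat"
  Fmat :: "nat \<Rightarrow> real mat"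
  hvec :: "nat \<Rightarrow> real vec"

definition well_formed :: "split_problem \<Rightarrow> bool" where
  "well_formed P \<longleftrightarrow>
     0 < T1 P \<and> T1 P < Tend P \<and>
     xinit P \<in> carrier_vec (xdim P 0) \<and>
     (\<forall>t<T1 P.
        (\<forall>x\<in>carrier_vec (xdim P t). \<forall>u\<in>carrier_vec (udim P t).
           dyn P t x u \<in> carrier_vec (xdim P (Suc t))) \<and>
        Zset P t \<subseteq> carrier_vec (xdim P t) \<times> carrier_vec (udim P t)) \<and>
     (\<forall>t\<in>{T1 P..<Tend P}.
        cvec P t \<in> carrier_vec (xdim P t) \<and>
        dvec P t \<in> carrier_vec (udim P t) \<and>
        Amat P t \<in> carrier_mat (xdim P (Suc t)) (xdim P t) \<and>
        Bmat P t \<in> carrier_mat (xdim P (Suc t)) (udim P t) \<and>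
        Emat P t \<in> carrier_mat (cdim P t) (xdim P t) \<and>
        Fmat P t \<in> carrier_mat (cdim P t) (udim P t) \<and>
        hvec P t \<in> carrier_vec (cdim P t)) \<and>
     cvec P (Tend P) \<in> carrier_vec (xdim P (Tend P))"


section \<open>First stage\<close>

text \<open>
  A trajectory is a function of the time index; values outside the relevant time range are
  ignored. The given initial state is stored at index 0.
\<close>

definition first_feasible ::
  "split_problem \<Rightarrow> (nat \<Rightarrow> real vec) \<Rightarrow> (nat \<Rightarrow> real vec) \<Rightarrow> bool" where
  "first_feasible P x u \<longleftrightarrow>
     x 0 = xinit P \<and>
     (\<forall>t\<le>T1 P. x t \<in> carrier_vec (xdim P t)) \<and>
     (\<forall>t<T1 P. u t \<in> carrier_vec (udim P t) \<and>
        x (Suc t) = dyn P t (x t) (u t) \<and> (x t, u t) \<in> Zset P t)"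

definition first_cost ::
  "split_problem \<Rightarrow> (nat \<Rightarrow> real vec) \<Rightarrow> (nat \<Rightarrow> real vec) \<Rightarrow> real" where
  "first_cost P x u = (\<Sum>t<T1 P. gcost P t (x t) (u t))"

text \<open>
  Local optimality refers to neighbourhoods in the finite-dimensional space of the decision
  variables; they are given here by the maximum norm.
\<close>

definition vec_near :: "real \<Rightarrow> real vec \<Rightarrow> real vec \<Rightarrow> bool" where
  "vec_near \<epsilon> v w \<longleftrightarrow> dim_vec v = dim_vec w \<and> (\<forall>i<dim_vec v. \<bar>v $ i - w $ i\<bar> < \<epsilon>)"

definition first_near ::
  "split_problem \<Rightarrow> real \<Rightarrow> (nat \<Rightarrow> real vec) \<Rightarrow> (nat \<Rightarrow> real vec) \<Rightarrow>
   (nat \<Rightarrow> real vec) \<Rightarrow> (nat \<Rightarrow> real vec) \<Rightarrow> bool" where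
  "first_near P \<epsilon> x u x' u' \<longleftrightarrow>
     (\<forall>t\<le>T1 P. vec_near \<epsilon> (x t) (x' t)) \<and> (\<forall>t<T1 P. vec_near \<epsilon> (u t) (u' t))"

text \<open>
  The function \<open>G\<close> is the one that takes the place of the second-stage value function in the
  objective of the first-stage problem.
\<close>

definition nlp1_local_opt ::
  "split_problem \<Rightarrow> (real vec \<Rightarrow> real) \<Rightarrow> (nat \<Rightarrow> real vec) \<Rightarrow> (nat \<Rightarrow> real vec) \<Rightarrow> bool" where
  "nlp1_local_opt P G x u \<longleftrightarrow>
     first_feasible P x u \<and>
     (\<exists>\<epsilon>>0. \<forall>x' u'. first_feasible P x' u' \<and> first_near P \<epsilon> x u x' u' \<longrightarrow>
        first_cost P x u + G (x (T1 P)) \<le> first_cost P x' u' + G (x' (T1 P)))"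

definition nlp1_global_opt ::
  "split_problem \<Rightarrow> (real vec \<Rightarrow> real) \<Rightarrow> (nat \<Rightarrow> real vec) \<Rightarrow> (nat \<Rightarrow> real vec) \<Rightarrow> bool" where
  "nlp1_global_opt P G x u \<longleftrightarrow>
     first_feasible P x u \<and>
     (\<forall>x' u'. first_feasible P x' u' \<longrightarrow>
        first_cost P x u + G (x (T1 P)) \<le> first_cost P x' u' + G (x' (T1 P)))"


section \<open>Second stage and its linear programming dual\<close>

text \<open>The parameter \<open>\<xi>\<close> is the given state at time \<open>T1\<close>.\<close>

definition lp2_feasible ::
  "split_problem \<Rightarrow> real vec \<Rightarrow> (nat \<Rightarrow> real vec) \<Rightarrow> (nat \<Rightarrow> real vec) \<Rightarrow> bool" where
  "lp2_feasible P \<xi> y v \<longleftrightarrow>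
     y (T1 P) = \<xi> \<and>
     (\<forall>t\<in>{T1 P..Tend P}. y t \<in> carrier_vec (xdim P t)) \<and>
     (\<forall>t\<in>{T1 P..<Tend P}. v t \<in> carrier_vec (udim P t) \<and>
        y (Suc t) = Amat P t *\<^sub>v y t + Bmat P t *\<^sub>v v t \<and>
        Emat P t *\<^sub>v y t + Fmat P t *\<^sub>v v t \<le> hvec P t)"

definition lp2_cost ::
  "split_problem \<Rightarrow> (nat \<Rightarrow> real vec) \<Rightarrow> (nat \<Rightarrow> real vec) \<Rightarrow> real" where
  "lp2_cost P y v =
     (\<Sum>t\<in>{T1 P..<Tend P}. cvec P t \<bullet> y t + dvec P t \<bullet> v t) + cvec P (Tend P) \<bullet> y (Tend P)"

definition lp2_optimal ::
  "split_problem \<Rightarrow> real vec \<Rightarrow> (nat \<Rightarrow> real vec) \<Rightarrow> (nat \<Rightarrow> real vec) \<Rightarrow> bool" where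
  "lp2_optimal P \<xi> y v \<longleftrightarrow>
     lp2_feasible P \<xi> y v \<and>
     (\<forall>y' v'. lp2_feasible P \<xi> y' v' \<longrightarrow> lp2_cost P y v \<le> lp2_cost P y' v')"

text \<open>
  The dual comes from the Lagrangian in which \<open>\<lambda> t\<close> multiplies \<open>A y t + B v t - y (t + 1)\<close> and
  \<open>\<nu> t \<ge> 0\<close> multiplies \<open>E y t + F v t - h\<close>. Dual feasibility says that the coefficients of
  \<open>v t\<close> (for \<open>T1 \<le> t < Tend\<close>) and of \<open>y t\<close> (for \<open>T1 < t \<le> Tend\<close>) vanish. The state at \<open>T1\<close> is
  data, so its coefficient \<open>cut_slope\<close> remains and gives the dependence on \<open>\<xi>\<close>.
\<close>

definition dual_feasible ::
  "split_problem \<Rightarrow> (nat \<Rightarrow> real vec) \<Rightarrow> (nat \<Rightarrow> real vec) \<Rightarrow> bool" where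
  "dual_feasible P lam nu \<longleftrightarrow>
     (\<forall>t\<in>{T1 P..<Tend P}.
        lam t \<in> carrier_vec (xdim P (Suc t)) \<and>
        nu t \<in> carrier_vec (cdim P t) \<and> 0\<^sub>v (cdim P t) \<le> nu t \<and>
        transpose_mat (Bmat P t) *\<^sub>v lam t + transpose_mat (Fmat P t) *\<^sub>v nu t + dvec P t
          = 0\<^sub>v (udim P t)) \<and>
     (\<forall>t\<in>{Suc (T1 P)..<Tend P}.
        transpose_mat (Amat P t) *\<^sub>v lam t + transpose_mat (Emat P t) *\<^sub>v nu t + cvec P t
          = lam (t - 1)) \<and>
     cvec P (Tend P) = lam (Tend P - 1)"

definition cut_slope ::
  "split_problem \<Rightarrow> (nat \<Rightarrow> real vec) \<Rightarrow> (nat \<Rightarrow> real vec) \<Rightarrow> real vec" where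
  "cut_slope P lam nu =
     transpose_mat (Amat P (T1 P)) *\<^sub>v lam (T1 P)
       + transpose_mat (Emat P (T1 P)) *\<^sub>v nu (T1 P) + cvec P (T1 P)"

text \<open>
  The intercept contains the inequality multipliers of all second-stage times. For
  \<open>Tend = T1 + 1\<close> it is \<open>- (\<nu> T1 \<bullet> h T1)\<close>; for longer horizons the terms with \<open>t > T1\<close> are
  needed, since otherwise the cut is in general neither valid nor tight.
\<close>

definition cut_offset :: "split_problem \<Rightarrow> (nat \<Rightarrow> real vec) \<Rightarrow> real" where
  "cut_offset P nu = - (\<Sum>t\<in>{T1 P..<Tend P}. nu t \<bullet> hvec P t)"

definition dual_value ::
  "split_problem \<Rightarrow> real vec \<Rightarrow> (nat \<Rightarrow> real vec) \<Rightarrow> (nat \<Rightarrow> real vec) \<Rightarrow> real" where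
  "dual_value P \<xi> lam nu = cut_slope P lam nu \<bullet> \<xi> - (\<Sum>t\<in>{T1 P..<Tend P}. nu t \<bullet> hvec P t)"

definition dual_optimal ::
  "split_problem \<Rightarrow> real vec \<Rightarrow> (nat \<Rightarrow> real vec) \<Rightarrow> (nat \<Rightarrow> real vec) \<Rightarrow> bool" where
  "dual_optimal P \<xi> lam nu \<longleftrightarrow>
     dual_feasible P lam nu \<and>
     (\<forall>lam' nu'. dual_feasible P lam' nu' \<longrightarrow> dual_value P \<xi> lam' nu' \<le> dual_value P \<xi> lam nu)"


section \<open>Two-stage problem\<close>

definition ts_feasible ::
  "split_problem \<Rightarrow> (nat \<Rightarrow> real vec) \<Rightarrow> (nat \<Rightarrow> real vec) \<Rightarrow>
   (nat \<Rightarrow> real vec) \<Rightarrow> (nat \<Rightarrow> real vec) \<Rightarrow> bool" where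
  "ts_feasible P x u y v \<longleftrightarrow> first_feasible P x u \<and> lp2_feasible P (x (T1 P)) y v"

definition ts_cost ::
  "split_problem \<Rightarrow> (nat \<Rightarrow> real vec) \<Rightarrow> (nat \<Rightarrow> real vec) \<Rightarrow>
   (nat \<Rightarrow> real vec) \<Rightarrow> (nat \<Rightarrow> real vec) \<Rightarrow> real" where
  "ts_cost P x u y v = first_cost P x u + lp2_cost P y v"

definition second_near ::
  "split_problem \<Rightarrow> real \<Rightarrow> (nat \<Rightarrow> real vec) \<Rightarrow> (nat \<Rightarrow> real vec) \<Rightarrow>
   (nat \<Rightarrow> real vec) \<Rightarrow> (nat \<Rightarrow> real vec) \<Rightarrow> bool" where
  "second_near P \<epsilon> y v y' v' \<longleftrightarrow>
     (\<forall>t\<in>{T1 P..Tend P}. vec_near \<epsilon> (y t) (y' t)) \<and>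
     (\<forall>t\<in>{T1 P..<Tend P}. vec_near \<epsilon> (v t) (v' t))"

definition ts_local_opt ::
  "split_problem \<Rightarrow> (nat \<Rightarrow> real vec) \<Rightarrow> (nat \<Rightarrow> real vec) \<Rightarrow>
   (nat \<Rightarrow> real vec) \<Rightarrow> (nat \<Rightarrow> real vec) \<Rightarrow> bool" where
  "ts_local_opt P x u y v \<longleftrightarrow>
     ts_feasible P x u y v \<and>
     (\<exists>\<epsilon>>0. \<forall>x' u' y' v'.
        ts_feasible P x' u' y' v' \<and> first_near P \<epsilon> x u x' u' \<and> second_near P \<epsilon> y v y' v' \<longrightarrow>
        ts_cost P x u y v \<le> ts_cost P x' u' y' v')"

definition ts_global_opt ::
  "split_problem \<Rightarrow> (nat \<Rightarrow> real vec) \<Rightarrow> (nat \<Rightarrow> real vec) \<Rightarrow>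
   (nat \<Rightarrow> real vec) \<Rightarrow> (nat \<Rightarrow> real vec) \<Rightarrow> bool" where
  "ts_global_opt P x u y v \<longleftrightarrow>
     ts_feasible P x u y v \<and>
     (\<forall>x' u' y' v'. ts_feasible P x' u' y' v' \<longrightarrow> ts_cost P x u y v \<le> ts_cost P x' u' y' v')"


section \<open>Split-horizon DDP algorithm\<close>

text \<open>
  An execution is described by the answers of the solvers, indexed by the iteration number \<open>k\<close>:
  \<open>x k\<close>, \<open>u k\<close> is the first-stage solution with which iteration \<open>k\<close> starts (from step 1 if
  \<open>k = 0\<close>, from step 6 of iteration \<open>k - 1\<close> otherwise); \<open>y k\<close>, \<open>v k\<close>, \<open>lam k\<close>, \<open>nu k\<close> are the
  primal and dual solutions from step 2 of iteration \<open>k\<close>. The answers are arbitrary sequences, so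
  a solver may depend on the whole history. Answers after the stop are irrelevant.
\<close>

fun cuts ::
  "split_problem \<Rightarrow> (nat \<Rightarrow> nat \<Rightarrow> real vec) \<Rightarrow> (nat \<Rightarrow> nat \<Rightarrow> real vec) \<Rightarrow> nat \<Rightarrow>
   (real vec \<times> real) set" where
  "cuts P lam nu 0 = {}"
| "cuts P lam nu (Suc k) =
     cuts P lam nu k \<union> {(cut_slope P (lam k) (nu k), cut_offset P (nu k))}"

definition lower_approx :: "(real vec \<times> real) set \<Rightarrow> real vec \<Rightarrow> real" where
  "lower_approx H \<xi> = Max ((\<lambda>(a, b). a \<bullet> \<xi> + b) ` H)"

text \<open>The values of \<open>UB\<close> and \<open>LB\<close> when step 4 of iteration \<open>k\<close> is executed.\<close>

definition UB ::
  "split_problem \<Rightarrow> (nat \<Rightarrow> nat \<Rightarrow> real vec) \<Rightarrow> (nat \<Rightarrow> nat \<Rightarrow> real vec) \<Rightarrow> nat \<Rightarrow> ereal" where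
  "UB P y v k = ereal (lp2_cost P (y k) (v k))"

fun LB ::
  "split_problem \<Rightarrow> (nat \<Rightarrow> nat \<Rightarrow> real vec) \<Rightarrow> (nat \<Rightarrow> nat \<Rightarrow> real vec) \<Rightarrow>
   (nat \<Rightarrow> nat \<Rightarrow> real vec) \<Rightarrow> nat \<Rightarrow> ereal" where
  "LB P x lam nu 0 = - \<infinity>"
| "LB P x lam nu (Suc k) =
     ereal (lower_approx (cuts P lam nu (Suc k)) (x (Suc k) (T1 P)))"

definition stop_test ::
  "split_problem \<Rightarrow> (nat \<Rightarrow> nat \<Rightarrow> real vec) \<Rightarrow> (nat \<Rightarrow> nat \<Rightarrow> real vec) \<Rightarrow>
   (nat \<Rightarrow> nat \<Rightarrow> real vec) \<Rightarrow> (nat \<Rightarrow> nat \<Rightarrow> real vec) \<Rightarrow>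
   (nat \<Rightarrow> nat \<Rightarrow> real vec) \<Rightarrow> nat \<Rightarrow> bool" where
  "stop_test P x y v lam nu k \<longleftrightarrow> UB P y v k = LB P x lam nu k"

text \<open>Iteration \<open>k\<close> is executed.\<close>

definition reached ::
  "split_problem \<Rightarrow> (nat \<Rightarrow> nat \<Rightarrow> real vec) \<Rightarrow> (nat \<Rightarrow> nat \<Rightarrow> real vec) \<Rightarrow>
   (nat \<Rightarrow> nat \<Rightarrow> real vec) \<Rightarrow> (nat \<Rightarrow> nat \<Rightarrow> real vec) \<Rightarrow>
   (nat \<Rightarrow> nat \<Rightarrow> real vec) \<Rightarrow> nat \<Rightarrow> bool" where
  "reached P x y v lam nu k \<longleftrightarrow> (\<forall>j<k. \<not> stop_test P x y v lam nu j)"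

end

theory Submission
  imports Defs
begin

text \<open>
  Every cut generated by the algorithm comes from a dual feasible point of (LP2). Whether a dual
  point is feasible does not depend on \<open>\<xi>\<close>, so by weak duality the cut \<open>a \<bullet> \<xi> + b\<close>, whose value is
  the dual objective at \<open>\<xi>\<close>, bounds the cost of every feasible second stage from below, at every
  \<open>\<xi>\<close> (\<open>weak_duality\<close>, \<open>lower_approx_le_cost\<close>). By \<open>strong_duality\<close> a cut is tight at the state
  at which it was generated.

  For termination it is not enough to count vertices of the dual polyhedron, because the
  multipliers may be any optimal solution, not necessarily a vertex. Instead one counts
  supports. The gap between the primal and the dual objective is the sum of the products of
  \<open>\<nu>\<close> with the slacks (\<open>duality_gap\<close>). If iterations \<open>i < j\<close> have inequality multipliers with the
  same support, then complementary slackness for \<open>\<nu> j\<close> at the primal optimum of iteration \<open>j\<close>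
  makes the slack vanish wherever \<open>\<nu> i\<close> is nonzero. Hence the old cut \<open>i\<close> is already tight at the
  current state, \<open>LB\<close> reaches \<open>UB\<close>, and the algorithm stops in iteration \<open>j\<close>. There are only
  finitely many supports, so this happens eventually (\<open>support_subset_imp_tight\<close>,
  \<open>split_horizon_terminates\<close>). Geometrically, the dual feasible points with a given support form
  the relative interior of a face of the dual polyhedron, and a face with an optimal point in its
  relative interior consists of optimal points only.

  When the algorithm stops, the lower approximation agrees with the second-stage cost at the
  current state, while elsewhere it lies below. A first-stage solution that is locally or globally
  optimal for the lower approximation is therefore, together with its second stage, optimal in the
  same sense for the two-stage problem.

  Strong duality is obtained from Farkas' lemma. The lemma is proved for a linear subspace of tuples
  of reals, and applied to the space of slacks and costs of all homogenised trajectories, those with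
  \<open>y T1 = r \<cdot> \<xi>\<close> for some real \<open>r\<close>. It yields multipliers for the inequality rows and for \<open>0 \<le> r\<close>; the
  multipliers of the dynamics then follow from the costate recursion backwards in time.
\<close>

section \<open>Farkas' lemma for subspaces\<close>

text \<open>
  The real number that comes with each tuple is the value of the functional that has to be written
  as a nonnegative combination of the entries. Letting the subspace vary makes an induction on the number of
  entries possible: if the functional is negative somewhere although all entries in \<open>I\<close> are
  nonnegative, then entry \<open>k\<close> must be negative there, and the induction passes to the subspace on
  which entry \<open>k\<close> vanishes.
\<close>
lemma farkas_subspace:
  fixes S :: "(('i \<Rightarrow> real) \<times> real) set"
  assumes "finite I"
    and "\<And>a b s p s' p'. (s, p) \<in> S \<Longrightarrow> (s', p') \<in> S \<Longrightarrow>
      ((\<lambda>i. a * s i + b * s' i), a * p + b * p') \<in> S"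
    and "\<And>s p. (s, p) \<in> S \<Longrightarrow> \<forall>i\<in>I. 0 \<le> s i \<Longrightarrow> 0 \<le> p"
  shows "\<exists>w. (\<forall>i\<in>I. 0 \<le> w i) \<and> (\<forall>(s, p)\<in>S. p = (\<Sum>i\<in>I. w i * s i))"
  using assms
proof (induction I arbitrary: S rule: finite_induct)
  case empty
  have "p = 0" if "(s, p) \<in> S" for s p
  proof -
    have "((\<lambda>i. (-1) * s i + 0 * s i), (-1) * p + 0 * p) \<in> S"
      using empty.prems(1) that by blast
    then have "0 \<le> (-1) * p + 0 * p"
      using empty.prems(2) by blast
    moreover have "0 \<le> p"
      using empty.prems(2) that by blast
    ultimately show ?thesis by simp
  qed
  then show ?case by auto
next
  case (insert k I)
  show ?case
  proof (cases "\<forall>(s, p)\<in>S. (\<forall>i\<in>I. 0 \<le> s i) \<longrightarrow> 0 \<le> p")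
    case True
    then have "\<exists>w. (\<forall>i\<in>I. 0 \<le> w i) \<and> (\<forall>(s, p)\<in>S. p = (\<Sum>i\<in>I. w i * s i))"
      using insert.prems(1) by (intro insert.IH) blast+
    then obtain w where w: "\<forall>i\<in>I. 0 \<le> w i" "\<forall>(s, p)\<in>S. p = (\<Sum>i\<in>I. w i * s i)"
      by blast
    have "(\<Sum>i\<in>insert k I. (w(k := 0)) i * s i) = (\<Sum>i\<in>I. w i * s i)" for s :: "'i \<Rightarrow> real"
    proof -
      have "(\<Sum>i\<in>I. (w(k := 0)) i * s i) = (\<Sum>i\<in>I. w i * s i)"
        using insert.hyps(2) by (intro sum.cong) auto
      then show ?thesis using insert.hyps by simp
    qed
    with w show ?thesis by (intro exI[of _ "w(k := 0)"]) auto
  next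
    case False
    then obtain s0 p0 where s0: "(s0, p0) \<in> S" "\<forall>i\<in>I. 0 \<le> s0 i" "p0 < 0"
      by force
    with insert.prems(2)[OF s0(1)] have neg: "s0 k < 0" by force
    \<comment> \<open>Subtracting a multiple of \<open>s0\<close> projects \<open>S\<close> onto its members with vanishing entry \<open>k\<close>,
      where the induction hypothesis applies.\<close>
    define S' where "S' = {(s, p) \<in> S. s k = 0}"
    have "\<exists>w. (\<forall>i\<in>I. 0 \<le> w i) \<and> (\<forall>(s, p)\<in>S'. p = (\<Sum>i\<in>I. w i * s i))"
    proof (rule insert.IH)
      show "((\<lambda>i. a * s i + b * s' i), a * p + b * p') \<in> S'"
        if "(s, p) \<in> S'" "(s', p') \<in> S'" for a b s p s' p'
        using that insert.prems(1) by (auto simp: S'_def)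
      show "0 \<le> p" if "(s, p) \<in> S'" "\<forall>i\<in>I. 0 \<le> s i" for s p
        using that insert.prems(2) by (auto simp: S'_def)
    qed
    then obtain w where w: "\<forall>i\<in>I. 0 \<le> w i" "\<forall>(s, p)\<in>S'. p = (\<Sum>i\<in>I. w i * s i)"
      by blast
    define wk where "wk = (p0 - (\<Sum>i\<in>I. w i * s0 i)) / s0 k"
    have "0 \<le> (\<Sum>i\<in>I. w i * s0 i)"
      using w(1) s0(2) by (intro sum_nonneg) auto
    then have wk: "0 \<le> wk"
      using s0(3) neg by (simp add: wk_def divide_nonpos_neg)
    have "p = (\<Sum>i\<in>I. w i * s i) + wk * s k" if "(s, p) \<in> S" for s p
    proof -
      define q where "q = s k / s0 k"
      have "((\<lambda>i. 1 * s i + (- q) * s0 i), 1 * p + (- q) * p0) \<in> S'"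
        using insert.prems(1)[OF that s0(1), of 1 "- q"] neg by (auto simp: S'_def q_def)
      then have "p - q * p0 = (\<Sum>i\<in>I. w i * (s i - q * s0 i))"
        using w(2) by fastforce
      also have "\<dots> = (\<Sum>i\<in>I. w i * s i) - q * (\<Sum>i\<in>I. w i * s0 i)"
        by (simp add: right_diff_distrib sum_subtractf sum_distrib_left mult.left_commute)
      finally have "p = (\<Sum>i\<in>I. w i * s i) + q * (p0 - (\<Sum>i\<in>I. w i * s0 i))"
        by (simp add: algebra_simps)
      then show ?thesis by (simp add: q_def wk_def)
    qed
    moreover have "(\<Sum>i\<in>insert k I. (w(k := wk)) i * s i) = (\<Sum>i\<in>I. w i * s i) + wk * s k"
      for s :: "'i \<Rightarrow> real"
    proof -
      have "(\<Sum>i\<in>I. (w(k := wk)) i * s i) = (\<Sum>i\<in>I. w i * s i)"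
        using insert.hyps(2) by (intro sum.cong) auto
      then show ?thesis using insert.hyps by simp
    qed
    ultimately show ?thesis
      using w(1) wk by (intro exI[of _ "w(k := wk)"]) auto
  qed
qed


section \<open>Second-stage trajectories and their Lagrangian\<close>

definition lp2_dynamics ::
  "split_problem \<Rightarrow> (nat \<Rightarrow> real vec) \<Rightarrow> (nat \<Rightarrow> real vec) \<Rightarrow> bool" where
  "lp2_dynamics P y v \<longleftrightarrow>
     (\<forall>t\<in>{T1 P..Tend P}. y t \<in> carrier_vec (xdim P t)) \<and>
     (\<forall>t\<in>{T1 P..<Tend P}. v t \<in> carrier_vec (udim P t) \<and>
        y (Suc t) = Amat P t *\<^sub>v y t + Bmat P t *\<^sub>v v t)"

definition lp2_rows ::
  "split_problem \<Rightarrow> (nat \<Rightarrow> real vec) \<Rightarrow> (nat \<Rightarrow> real vec) \<Rightarrow> nat \<Rightarrow> real vec" where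
  "lp2_rows P y v t = Emat P t *\<^sub>v y t + Fmat P t *\<^sub>v v t"

text \<open>
  Dual feasibility without the sign condition and without the equations for the inputs: what
  remains determines \<open>lam\<close> from \<open>nu\<close>.
\<close>
definition costate ::
  "split_problem \<Rightarrow> (nat \<Rightarrow> real vec) \<Rightarrow> (nat \<Rightarrow> real vec) \<Rightarrow> bool" where
  "costate P lam nu \<longleftrightarrow>
     (\<forall>t\<in>{T1 P..<Tend P}. lam t \<in> carrier_vec (xdim P (Suc t)) \<and> nu t \<in> carrier_vec (cdim P t)) \<and>
     (\<forall>t\<in>{Suc (T1 P)..<Tend P}.
        transpose_mat (Amat P t) *\<^sub>v lam t + transpose_mat (Emat P t) *\<^sub>v nu t + cvec P t
          = lam (t - 1)) \<and>
     cvec P (Tend P) = lam (Tend P - 1)"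

definition input_gradient ::
  "split_problem \<Rightarrow> (nat \<Rightarrow> real vec) \<Rightarrow> (nat \<Rightarrow> real vec) \<Rightarrow> nat \<Rightarrow> real vec" where
  "input_gradient P lam nu t =
     transpose_mat (Bmat P t) *\<^sub>v lam t + transpose_mat (Fmat P t) *\<^sub>v nu t + dvec P t"

lemma dual_feasible_iff:
  "dual_feasible P lam nu \<longleftrightarrow> costate P lam nu \<and>
     (\<forall>t\<in>{T1 P..<Tend P}. 0\<^sub>v (cdim P t) \<le> nu t \<and> input_gradient P lam nu t = 0\<^sub>v (udim P t))"
  unfolding dual_feasible_def costate_def input_gradient_def by blast

lemma lp2_feasible_iff:
  "lp2_feasible P \<xi> y v \<longleftrightarrow> y (T1 P) = \<xi> \<and> lp2_dynamics P y v \<and>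
     (\<forall>t\<in>{T1 P..<Tend P}. lp2_rows P y v t \<le> hvec P t)"
  unfolding lp2_feasible_def lp2_dynamics_def lp2_rows_def by blast

lemma well_formed_second_stage:
  assumes "well_formed P" "t \<in> {T1 P..<Tend P}"
  shows "cvec P t \<in> carrier_vec (xdim P t)" "dvec P t \<in> carrier_vec (udim P t)"
    "Amat P t \<in> carrier_mat (xdim P (Suc t)) (xdim P t)"
    "Bmat P t \<in> carrier_mat (xdim P (Suc t)) (udim P t)"
    "Emat P t \<in> carrier_mat (cdim P t) (xdim P t)"
    "Fmat P t \<in> carrier_mat (cdim P t) (udim P t)"
    "hvec P t \<in> carrier_vec (cdim P t)"
  using assms unfolding well_formed_def by blast+

lemma lp2_dynamicsD:
  assumes "lp2_dynamics P y v" "t \<in> {T1 P..<Tend P}"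
  shows "y t \<in> carrier_vec (xdim P t)" "y (Suc t) \<in> carrier_vec (xdim P (Suc t))"
    "v t \<in> carrier_vec (udim P t)" "y (Suc t) = Amat P t *\<^sub>v y t + Bmat P t *\<^sub>v v t"
proof -
  have "t \<in> {T1 P..Tend P}" "Suc t \<in> {T1 P..Tend P}" using assms(2) by auto
  with assms show "y t \<in> carrier_vec (xdim P t)" "y (Suc t) \<in> carrier_vec (xdim P (Suc t))"
    "v t \<in> carrier_vec (udim P t)" "y (Suc t) = Amat P t *\<^sub>v y t + Bmat P t *\<^sub>v v t"
    unfolding lp2_dynamics_def by blast+
qed

lemma lp2_rows_carrier:
  assumes "well_formed P" "lp2_dynamics P y v" "t \<in> {T1 P..<Tend P}"
  shows "lp2_rows P y v t \<in> carrier_vec (cdim P t)"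
  using well_formed_second_stage[OF assms(1,3)] lp2_dynamicsD[OF assms(2,3)]
  unfolding lp2_rows_def by auto

text \<open>
  Transposition moves all matrices to the multipliers, which collects the terms in \<open>y\<close> and in \<open>v\<close>.
\<close>
lemma lagrangian_stage:
  fixes A B E F :: "real mat"
  assumes "A \<in> carrier_mat n' n" "B \<in> carrier_mat n' m" "E \<in> carrier_mat q n" "F \<in> carrier_mat q m"
    and "c \<in> carrier_vec n" "d \<in> carrier_vec m" "l \<in> carrier_vec n'" "\<mu> \<in> carrier_vec q"
    and "y \<in> carrier_vec n" "v \<in> carrier_vec m"
  shows "c \<bullet> y + d \<bullet> v + \<mu> \<bullet> (E *\<^sub>v y + F *\<^sub>v v) =
      (transpose_mat A *\<^sub>v l + transpose_mat E *\<^sub>v \<mu> + c) \<bullet> y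
    + (transpose_mat B *\<^sub>v l + transpose_mat F *\<^sub>v \<mu> + d) \<bullet> v - l \<bullet> (A *\<^sub>v y + B *\<^sub>v v)"
proof -
  have "\<mu> \<bullet> (E *\<^sub>v y + F *\<^sub>v v) = \<mu> \<bullet> (E *\<^sub>v y) + \<mu> \<bullet> (F *\<^sub>v v)"
    using assms by (intro scalar_prod_add_distrib[of _ q]) auto
  moreover have "l \<bullet> (A *\<^sub>v y + B *\<^sub>v v) = l \<bullet> (A *\<^sub>v y) + l \<bullet> (B *\<^sub>v v)"
    using assms by (intro scalar_prod_add_distrib[of _ n']) auto
  moreover have "(transpose_mat A *\<^sub>v l + transpose_mat E *\<^sub>v \<mu> + c) \<bullet> y
      = (transpose_mat A *\<^sub>v l) \<bullet> y + (transpose_mat E *\<^sub>v \<mu>) \<bullet> y + c \<bullet> y"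
    using assms by (simp add: add_scalar_prod_distrib[of _ n])
  moreover have "(transpose_mat B *\<^sub>v l + transpose_mat F *\<^sub>v \<mu> + d) \<bullet> v
      = (transpose_mat B *\<^sub>v l) \<bullet> v + (transpose_mat F *\<^sub>v \<mu>) \<bullet> v + d \<bullet> v"
    using assms by (simp add: add_scalar_prod_distrib[of _ m])
  moreover have "(transpose_mat A *\<^sub>v l) \<bullet> y = l \<bullet> (A *\<^sub>v y)" "(transpose_mat E *\<^sub>v \<mu>) \<bullet> y = \<mu> \<bullet> (E *\<^sub>v y)"
    "(transpose_mat B *\<^sub>v l) \<bullet> v = l \<bullet> (B *\<^sub>v v)" "(transpose_mat F *\<^sub>v \<mu>) \<bullet> v = \<mu> \<bullet> (F *\<^sub>v v)"
    using assms by (auto intro: transpose_vec_mult_scalar)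
  ultimately show ?thesis by simp
qed

text \<open>
  The Lagrangian is affine in the inputs and the initial state alone: by the costate recursion the
  contributions of the intermediate states telescope.
\<close>
lemma lagrangian_identity:
  assumes wf: "well_formed P" and dyn: "lp2_dynamics P y v" and co: "costate P lam nu"
  shows "lp2_cost P y v + (\<Sum>t\<in>{T1 P..<Tend P}. nu t \<bullet> lp2_rows P y v t) =
    cut_slope P lam nu \<bullet> y (T1 P) + (\<Sum>t\<in>{T1 P..<Tend P}. input_gradient P lam nu t \<bullet> v t)"
proof -
  have T: "T1 P < Tend P" using wf by (simp add: well_formed_def)
  define \<pi> where "\<pi> t = transpose_mat (Amat P t) *\<^sub>v lam t
    + transpose_mat (Emat P t) *\<^sub>v nu t + cvec P t" for t
  have stage: "cvec P t \<bullet> y t + dvec P t \<bullet> v t + nu t \<bullet> lp2_rows P y v t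
      = \<pi> t \<bullet> y t + input_gradient P lam nu t \<bullet> v t - lam t \<bullet> y (Suc t)"
    if t: "t \<in> {T1 P..<Tend P}" for t
  proof -
    have "lam t \<in> carrier_vec (xdim P (Suc t))" "nu t \<in> carrier_vec (cdim P t)"
      using co t unfolding costate_def by blast+
    then show ?thesis
      unfolding lp2_rows_def \<pi>_def input_gradient_def lp2_dynamicsD(4)[OF dyn t]
      using well_formed_second_stage[OF wf t] lp2_dynamicsD[OF dyn t]
      by (intro lagrangian_stage)
  qed
  have "(\<Sum>t\<in>{T1 P..<m}. cvec P t \<bullet> y t + dvec P t \<bullet> v t + nu t \<bullet> lp2_rows P y v t)
      = \<pi> (T1 P) \<bullet> y (T1 P) + (\<Sum>t\<in>{T1 P..<m}. input_gradient P lam nu t \<bullet> v t)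
        - lam (m - 1) \<bullet> y m" if "Suc (T1 P) \<le> m" "m \<le> Tend P" for m
    using that
  proof (induction m rule: dec_induct)
    case base
    then show ?case using stage[of "T1 P"] by simp
  next
    case (step m)
    then have "\<pi> m = lam (m - 1)"
      using co unfolding costate_def \<pi>_def by auto
    with step stage[of m] show ?case by simp
  qed
  from this[of "Tend P"] T
  have "(\<Sum>t\<in>{T1 P..<Tend P}. cvec P t \<bullet> y t + dvec P t \<bullet> v t + nu t \<bullet> lp2_rows P y v t)
      = cut_slope P lam nu \<bullet> y (T1 P) + (\<Sum>t\<in>{T1 P..<Tend P}. input_gradient P lam nu t \<bullet> v t)
        - cvec P (Tend P) \<bullet> y (Tend P)"
    using co by (simp add: costate_def \<pi>_def cut_slope_def)
  then show ?thesis
    by (simp add: lp2_cost_def sum.distrib)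
qed


section \<open>Weak duality and complementary slackness\<close>

text \<open>
  Dual feasibility removes the inputs from the Lagrangian. The identity holds with any dual feasible
  point, optimal or not, which is what allows multipliers of an earlier iteration to be tested
  against a later primal solution.
\<close>
lemma duality_gap:
  assumes wf: "well_formed P" and dual: "dual_feasible P lam nu" and primal: "lp2_feasible P \<xi> y v"
  shows "lp2_cost P y v - dual_value P \<xi> lam nu =
    (\<Sum>t\<in>{T1 P..<Tend P}. \<Sum>i<cdim P t. nu t $ i * (hvec P t $ i - lp2_rows P y v t $ i))"
proof -
  have dyn: "lp2_dynamics P y v" and \<xi>: "y (T1 P) = \<xi>"
    using primal by (auto simp: lp2_feasible_iff)
  have "input_gradient P lam nu t \<bullet> v t = 0" if "t \<in> {T1 P..<Tend P}" for t
    using dual that lp2_dynamicsD(3)[OF dyn that] by (simp add: dual_feasible_iff)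
  then have "lp2_cost P y v - dual_value P \<xi> lam nu =
      (\<Sum>t\<in>{T1 P..<Tend P}. nu t \<bullet> hvec P t - nu t \<bullet> lp2_rows P y v t)"
    using lagrangian_identity[OF wf dyn, of lam nu] dual \<xi>
    by (simp add: dual_feasible_iff dual_value_def sum_subtractf del: sum_subtractf_nat)
  also have "\<dots> = (\<Sum>t\<in>{T1 P..<Tend P}. \<Sum>i<cdim P t. nu t $ i * (hvec P t $ i - lp2_rows P y v t $ i))"
  proof (rule sum.cong[OF refl])
    fix t assume "t \<in> {T1 P..<Tend P}"
    from lp2_rows_carrier[OF wf dyn this] well_formed_second_stage(7)[OF wf this]
    show "nu t \<bullet> hvec P t - nu t \<bullet> lp2_rows P y v t
      = (\<Sum>i<cdim P t. nu t $ i * (hvec P t $ i - lp2_rows P y v t $ i))"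
      by (simp add: scalar_prod_def lessThan_atLeast0 right_diff_distrib sum_subtractf)
  qed
  finally show ?thesis .
qed

lemma gap_term_nonneg:
  assumes "well_formed P" "dual_feasible P lam nu" "lp2_feasible P \<xi> y v"
    and t: "t \<in> {T1 P..<Tend P}" and i: "i < cdim P t"
  shows "0 \<le> nu t $ i" "0 \<le> nu t $ i * (hvec P t $ i - lp2_rows P y v t $ i)"
proof -
  have "0\<^sub>v (cdim P t) \<le> nu t" and nu: "nu t \<in> carrier_vec (cdim P t)"
    using assms(2) t by (auto simp: dual_feasible_def)
  then show *: "0 \<le> nu t $ i"
    using i by (auto simp: less_eq_vec_def)
  have "lp2_rows P y v t \<le> hvec P t"
    using assms(3) t by (auto simp: lp2_feasible_iff)
  then have "lp2_rows P y v t $ i \<le> hvec P t $ i"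
    using i well_formed_second_stage(7)[OF assms(1) t] by (auto simp: less_eq_vec_def)
  with * show "0 \<le> nu t $ i * (hvec P t $ i - lp2_rows P y v t $ i)"
    by simp
qed

lemma weak_duality:
  assumes "well_formed P" "dual_feasible P lam nu" "lp2_feasible P \<xi> y v"
  shows "dual_value P \<xi> lam nu \<le> lp2_cost P y v"
proof -
  have "0 \<le> lp2_cost P y v - dual_value P \<xi> lam nu"
    unfolding duality_gap[OF assms] using gap_term_nonneg(2)[OF assms]
    by (intro sum_nonneg) auto
  then show ?thesis by simp
qed

definition dual_support :: "split_problem \<Rightarrow> (nat \<Rightarrow> real vec) \<Rightarrow> (nat \<times> nat) set" where
  "dual_support P nu = {(t, i). t \<in> {T1 P..<Tend P} \<and> i < cdim P t \<and> nu t $ i \<noteq> 0}"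

lemma finite_dual_supports: "finite (range (\<lambda>k. dual_support P (nu k)))"
proof (rule finite_subset)
  show "range (\<lambda>k. dual_support P (nu k)) \<subseteq> Pow (SIGMA t:{T1 P..<Tend P}. {..<cdim P t})"
    by (auto simp: dual_support_def)
qed auto

text \<open>
  All terms of a vanishing gap vanish, so the slack is zero wherever \<open>nu\<close> is not; a multiplier
  whose support is contained in that of \<open>nu\<close> therefore has no gap either.
\<close>
lemma support_subset_imp_tight:
  assumes wf: "well_formed P" and dual: "dual_feasible P lam nu" and primal: "lp2_feasible P \<xi> y v"
    and tight: "dual_value P \<xi> lam nu = lp2_cost P y v"
    and dual': "dual_feasible P lam' nu'" and supp: "dual_support P nu' \<subseteq> dual_support P nu"
  shows "dual_value P \<xi> lam' nu' = lp2_cost P y v"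
proof -
  let ?gap = "\<lambda>\<mu> t i. \<mu> t $ i * (hvec P t $ i - lp2_rows P y v t $ i)"
  have nonneg: "0 \<le> (\<Sum>i<cdim P t. ?gap nu t i)" if "t \<in> {T1 P..<Tend P}" for t
    using gap_term_nonneg(2)[OF wf dual primal that] by (intro sum_nonneg) auto
  have "(\<Sum>t\<in>{T1 P..<Tend P}. \<Sum>i<cdim P t. ?gap nu t i) = 0"
    using duality_gap[OF wf dual primal] tight by simp
  then have "(\<Sum>i<cdim P t. ?gap nu t i) = 0" if "t \<in> {T1 P..<Tend P}" for t
    using nonneg that by (subst (asm) sum_nonneg_eq_0_iff) auto
  then have slackness: "?gap nu t i = 0" if "t \<in> {T1 P..<Tend P}" "i < cdim P t" for t i
    using gap_term_nonneg(2)[OF wf dual primal that(1)] that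
    by (metis (no_types, lifting) finite_lessThan lessThan_iff sum_nonneg_eq_0_iff)
  have "?gap nu' t i = 0" if "t \<in> {T1 P..<Tend P}" "i < cdim P t" for t i
    using slackness[OF that] supp that by (auto simp: dual_support_def)
  then have "(\<Sum>t\<in>{T1 P..<Tend P}. \<Sum>i<cdim P t. ?gap nu' t i) = 0"
    by (intro sum.neutral ballI) auto
  then show ?thesis
    using duality_gap[OF wf dual' primal] by linarith
qed


section \<open>Strong duality\<close>

lemma lp2_linear_combination:
  fixes a b :: real
  assumes wf: "well_formed P" and dyn: "lp2_dynamics P y v" and dyn': "lp2_dynamics P y' v'"
  defines "yc \<equiv> \<lambda>t. a \<cdot>\<^sub>v y t + b \<cdot>\<^sub>v y' t" and "vc \<equiv> \<lambda>t. a \<cdot>\<^sub>v v t + b \<cdot>\<^sub>v v' t"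
  shows "lp2_dynamics P yc vc"
    and "lp2_cost P yc vc = a * lp2_cost P y v + b * lp2_cost P y' v'"
    and "\<And>t. t \<in> {T1 P..<Tend P} \<Longrightarrow>
      lp2_rows P yc vc t = a \<cdot>\<^sub>v lp2_rows P y v t + b \<cdot>\<^sub>v lp2_rows P y' v' t"
proof -
  have pair: "M *\<^sub>v (a \<cdot>\<^sub>v p + b \<cdot>\<^sub>v p') + N *\<^sub>v (a \<cdot>\<^sub>v q + b \<cdot>\<^sub>v q')
      = a \<cdot>\<^sub>v (M *\<^sub>v p + N *\<^sub>v q) + b \<cdot>\<^sub>v (M *\<^sub>v p' + N *\<^sub>v q')"
    if "M \<in> carrier_mat k n" "N \<in> carrier_mat k m" "p \<in> carrier_vec n" "p' \<in> carrier_vec n"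
      "q \<in> carrier_vec m" "q' \<in> carrier_vec m" for M N :: "real mat" and p p' q q' k n m
  proof -
    have "M *\<^sub>v (a \<cdot>\<^sub>v p + b \<cdot>\<^sub>v p') = a \<cdot>\<^sub>v (M *\<^sub>v p) + b \<cdot>\<^sub>v (M *\<^sub>v p')"
      "N *\<^sub>v (a \<cdot>\<^sub>v q + b \<cdot>\<^sub>v q') = a \<cdot>\<^sub>v (N *\<^sub>v q) + b \<cdot>\<^sub>v (N *\<^sub>v q')"
      using that by (simp_all add: mult_add_distrib_mat_vec[of _ k n]
          mult_add_distrib_mat_vec[of _ k m] mult_mat_vec[of _ k n] mult_mat_vec[of _ k m])
    then show ?thesis
      using that by (intro eq_vecI) (auto simp: algebra_simps)
  qed
  have sp: "c \<bullet> (a \<cdot>\<^sub>v p + b \<cdot>\<^sub>v p') = a * (c \<bullet> p) + b * (c \<bullet> p')"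
    if "c \<in> carrier_vec n" "p \<in> carrier_vec n" "p' \<in> carrier_vec n" for c p p' :: "real vec" and n
    using that by (simp add: scalar_prod_add_distrib[of _ n])
  show "lp2_dynamics P yc vc"
    unfolding lp2_dynamics_def yc_def vc_def
  proof (intro conjI ballI)
    fix t assume t: "t \<in> {T1 P..<Tend P}"
    note D = lp2_dynamicsD[OF dyn t] lp2_dynamicsD[OF dyn' t]
    show "a \<cdot>\<^sub>v v t + b \<cdot>\<^sub>v v' t \<in> carrier_vec (udim P t)"
      using D by simp
    show "a \<cdot>\<^sub>v y (Suc t) + b \<cdot>\<^sub>v y' (Suc t)
        = Amat P t *\<^sub>v (a \<cdot>\<^sub>v y t + b \<cdot>\<^sub>v y' t) + Bmat P t *\<^sub>v (a \<cdot>\<^sub>v v t + b \<cdot>\<^sub>v v' t)"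
      unfolding D(4,8)
      by (rule pair[symmetric]) (use D well_formed_second_stage[OF wf t] in auto)
  qed (use dyn dyn' in \<open>auto simp: lp2_dynamics_def\<close>)
  show "lp2_rows P yc vc t = a \<cdot>\<^sub>v lp2_rows P y v t + b \<cdot>\<^sub>v lp2_rows P y' v' t"
    if t: "t \<in> {T1 P..<Tend P}" for t
    unfolding lp2_rows_def yc_def vc_def
    by (rule pair) (use lp2_dynamicsD[OF dyn t] lp2_dynamicsD[OF dyn' t]
        well_formed_second_stage[OF wf t] in auto)
  have "cvec P t \<bullet> yc t + dvec P t \<bullet> vc t
      = a * (cvec P t \<bullet> y t + dvec P t \<bullet> v t) + b * (cvec P t \<bullet> y' t + dvec P t \<bullet> v' t)"
    if t: "t \<in> {T1 P..<Tend P}" for t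
    using lp2_dynamicsD[OF dyn t] lp2_dynamicsD[OF dyn' t] well_formed_second_stage[OF wf t]
    by (simp add: yc_def vc_def sp[of _ "xdim P t"] sp[of _ "udim P t"] algebra_simps)
  moreover have "cvec P (Tend P) \<bullet> yc (Tend P)
      = a * (cvec P (Tend P) \<bullet> y (Tend P)) + b * (cvec P (Tend P) \<bullet> y' (Tend P))"
    unfolding yc_def using wf dyn dyn'
    by (intro sp[of _ "xdim P (Tend P)"]) (auto simp: well_formed_def lp2_dynamics_def)
  ultimately show "lp2_cost P yc vc = a * lp2_cost P y v + b * lp2_cost P y' v'"
    by (simp add: lp2_cost_def sum.distrib sum_distrib_left distrib_left algebra_simps)
qed

text \<open>
  The inputs are free when the inequalities are ignored. In the proof of strong duality this shows
  that the coefficients of the inputs in the Lagrangian vanish.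
\<close>
lemma trajectory_exists:
  assumes wf: "well_formed P" and v: "\<And>t. t \<in> {T1 P..<Tend P} \<Longrightarrow> v t \<in> carrier_vec (udim P t)"
    and \<xi>: "\<xi> \<in> carrier_vec (xdim P (T1 P))"
  obtains y where "lp2_dynamics P y v" "y (T1 P) = \<xi>"
proof
  \<comment> \<open>Forward recursion, indexed by the number of steps after \<open>T1\<close>.\<close>
  define Y where
    "Y = rec_nat \<xi> (\<lambda>s p. Amat P (T1 P + s) *\<^sub>v p + Bmat P (T1 P + s) *\<^sub>v v (T1 P + s))"
  have Y: "Y 0 = \<xi>"
    "Y (Suc s) = Amat P (T1 P + s) *\<^sub>v Y s + Bmat P (T1 P + s) *\<^sub>v v (T1 P + s)" for s
    by (simp_all add: Y_def)
  have Y_carrier: "Y s \<in> carrier_vec (xdim P (T1 P + s))" if "T1 P + s \<le> Tend P" for s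
    using that
  proof (induction s)
    case 0
    then show ?case using \<xi> by (simp add: Y)
  next
    case (Suc s)
    then have "T1 P + s \<in> {T1 P..<Tend P}" by simp
    from well_formed_second_stage[OF wf this] v[OF this] Suc show ?case
      by (auto simp: Y)
  qed
  show "lp2_dynamics P (\<lambda>t. Y (t - T1 P)) v"
    unfolding lp2_dynamics_def
  proof (intro conjI ballI)
    fix t assume t: "t \<in> {T1 P..Tend P}"
    then show "Y (t - T1 P) \<in> carrier_vec (xdim P t)"
      using Y_carrier[of "t - T1 P"] by simp
  next
    fix t assume t: "t \<in> {T1 P..<Tend P}"
    then show "v t \<in> carrier_vec (udim P t)" by (rule v)
    from t show "Y (Suc t - T1 P) = Amat P t *\<^sub>v Y (t - T1 P) + Bmat P t *\<^sub>v v t"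
      using Y(2)[of "t - T1 P"] by (simp add: Suc_diff_le)
  qed
  show "Y (T1 P - T1 P) = \<xi>" by (simp add: Y)
qed

lemma costate_exists:
  assumes wf: "well_formed P" and nu: "\<And>t. t \<in> {T1 P..<Tend P} \<Longrightarrow> nu t \<in> carrier_vec (cdim P t)"
  obtains lam where "costate P lam nu"
proof
  \<comment> \<open>Backward recursion, indexed by the number \<open>s\<close> of steps before the last stage.\<close>
  define L where "L = rec_nat (cvec P (Tend P)) (\<lambda>s p. let t = Tend P - 1 - s in
    transpose_mat (Amat P t) *\<^sub>v p + transpose_mat (Emat P t) *\<^sub>v nu t + cvec P t)"
  have L: "L 0 = cvec P (Tend P)"
    "L (Suc s) = transpose_mat (Amat P (Tend P - 1 - s)) *\<^sub>v L s
       + transpose_mat (Emat P (Tend P - 1 - s)) *\<^sub>v nu (Tend P - 1 - s) + cvec P (Tend P - 1 - s)"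
    for s
    by (simp_all add: L_def Let_def)
  have T: "T1 P < Tend P" and cT: "cvec P (Tend P) \<in> carrier_vec (xdim P (Tend P))"
    using wf by (auto simp: well_formed_def)
  have L_carrier: "L s \<in> carrier_vec (xdim P (Tend P - s))" if "s < Tend P - T1 P" for s
    using that
  proof (induction s)
    case 0
    then show ?case using cT by (simp add: L)
  next
    case (Suc s)
    define t where "t = Tend P - 1 - s"
    have t: "t \<in> {T1 P..<Tend P}" "Tend P - s = Suc t" "Tend P - Suc s = t"
      using Suc.prems by (auto simp: t_def)
    have "L (Suc s) = transpose_mat (Amat P t) *\<^sub>v L s + transpose_mat (Emat P t) *\<^sub>v nu t + cvec P t"
      by (simp add: L t_def)
    with well_formed_second_stage[OF wf t(1)] nu[OF t(1)] Suc t show ?case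
      by auto
  qed
  show "costate P (\<lambda>t. L (Tend P - 1 - t)) nu"
    unfolding costate_def
  proof (intro conjI ballI)
    fix t assume t: "t \<in> {T1 P..<Tend P}"
    then show "nu t \<in> carrier_vec (cdim P t)" by (rule nu)
    from t have "Tend P - (Tend P - 1 - t) = Suc t" "Tend P - 1 - t < Tend P - T1 P" by auto
    then show "L (Tend P - 1 - t) \<in> carrier_vec (xdim P (Suc t))"
      using L_carrier[of "Tend P - 1 - t"] by simp
  next
    fix t assume t: "t \<in> {Suc (T1 P)..<Tend P}"
    then have "Tend P - 1 - (t - 1) = Suc (Tend P - 1 - t)" "Tend P - 1 - (Tend P - 1 - t) = t"
      by auto
    then show "transpose_mat (Amat P t) *\<^sub>v L (Tend P - 1 - t) + transpose_mat (Emat P t) *\<^sub>v nu t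
        + cvec P t = L (Tend P - 1 - (t - 1))"
      using L(2)[of "Tend P - 1 - t"] by metis
  qed (use T in \<open>simp add: L\<close>)
qed

text \<open>
  Homogenisation by \<open>r\<close> turns the affine set of trajectories from \<open>\<xi>\<close> into a subspace, to which
  Farkas' lemma applies. The multiplier \<open>\<mu>\<close> belongs to the constraint \<open>0 \<le> r\<close>; the instance \<open>r = 1\<close>
  is the usual Lagrangian bound, and the instance \<open>r = 0\<close> says that the linear part vanishes.
\<close>
lemma lagrange_multipliers_exist:
  assumes wf: "well_formed P" and opt: "lp2_optimal P \<xi> y v"
  obtains nu \<mu> where "\<And>t. nu t \<in> carrier_vec (cdim P t)" and "\<And>t. t \<in> {T1 P..<Tend P} \<Longrightarrow> 0\<^sub>v (cdim P t) \<le> nu t"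
    and "0 \<le> \<mu>"
    and "\<And>r y' v'. lp2_dynamics P y' v' \<Longrightarrow> y' (T1 P) = r \<cdot>\<^sub>v \<xi> \<Longrightarrow>
      lp2_cost P y' v' - r * lp2_cost P y v
        = (\<Sum>t\<in>{T1 P..<Tend P}. nu t \<bullet> (r \<cdot>\<^sub>v hvec P t - lp2_rows P y' v' t)) + \<mu> * r"
proof -
  have feas: "lp2_feasible P \<xi> y v" and dyn: "lp2_dynamics P y v"
    and best: "\<And>y' v'. lp2_feasible P \<xi> y' v' \<Longrightarrow> lp2_cost P y v \<le> lp2_cost P y' v'"
    using opt by (auto simp: lp2_optimal_def lp2_feasible_iff)
  have \<xi>: "\<xi> \<in> carrier_vec (xdim P (T1 P))"
    using feas wf by (auto simp: lp2_feasible_def well_formed_def)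
  have init: "y (T1 P) = \<xi>" using feas by (simp add: lp2_feasible_def)
  define J where "J = (SIGMA t:{T1 P..<Tend P}. {0..<cdim P t})"
  have finJ: "finite J" by (simp add: J_def)
  define slack where "slack r y' v' j = (case j of None \<Rightarrow> r
      | Some (t, i) \<Rightarrow> r * hvec P t $ i - lp2_rows P y' v' t $ i)"
    for r :: real and y' v' j
  \<comment> \<open>Entries off the index set are set to zero, since the rows are linear in the trajectory
    only within their dimensions.\<close>
  define ext where "ext r y' v' j = (if j \<in> insert None (Some ` J) then slack r y' v' j else 0)"
    for r :: real and y' v' j
  define S where "S = {(ext r y' v', lp2_cost P y' v' - r * lp2_cost P y v) | r y' v'.
     lp2_dynamics P y' v' \<and> y' (T1 P) = r \<cdot>\<^sub>v \<xi>}"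
  have "\<exists>w. (\<forall>j\<in>insert None (Some ` J). 0 \<le> w j) \<and>
      (\<forall>(s, p)\<in>S. p = (\<Sum>j\<in>insert None (Some ` J). w j * s j))"
  proof (rule farkas_subspace)
    show "finite (insert None (Some ` J))" using finJ by simp
  next
    fix a b :: real and s p s' p' assume "(s, p) \<in> S" "(s', p') \<in> S"
    then obtain r1 y1 v1 r2 y2 v2 where
      1: "s = ext r1 y1 v1" "p = lp2_cost P y1 v1 - r1 * lp2_cost P y v"
        "lp2_dynamics P y1 v1" "y1 (T1 P) = r1 \<cdot>\<^sub>v \<xi>" and
      2: "s' = ext r2 y2 v2" "p' = lp2_cost P y2 v2 - r2 * lp2_cost P y v"
        "lp2_dynamics P y2 v2" "y2 (T1 P) = r2 \<cdot>\<^sub>v \<xi>"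
      by (auto simp: S_def)
    define yc vc r where "yc = (\<lambda>t. a \<cdot>\<^sub>v y1 t + b \<cdot>\<^sub>v y2 t)" and "vc = (\<lambda>t. a \<cdot>\<^sub>v v1 t + b \<cdot>\<^sub>v v2 t)"
      and "r = a * r1 + b * r2"
    note C = lp2_linear_combination[OF wf 1(3) 2(3), where a = a and b = b, folded yc_def vc_def]
    have "yc (T1 P) = r \<cdot>\<^sub>v \<xi>"
      by (intro eq_vecI) (auto simp: yc_def r_def 1(4) 2(4) algebra_simps)
    moreover have "a * p + b * p' = lp2_cost P yc vc - r * lp2_cost P y v"
      by (simp add: 1 2 C(2) r_def algebra_simps)
    moreover have "(\<lambda>j. a * s j + b * s' j) = ext r yc vc"
    proof
      fix j
      have "r * hvec P t $ i - lp2_rows P yc vc t $ i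
          = a * (r1 * hvec P t $ i - lp2_rows P y1 v1 t $ i)
          + b * (r2 * hvec P t $ i - lp2_rows P y2 v2 t $ i)"
        if "t \<in> {T1 P..<Tend P}" "i < cdim P t" for t i
        using C(3)[OF that(1)] lp2_rows_carrier[OF wf 1(3) that(1)]
          lp2_rows_carrier[OF wf 2(3) that(1)] that
        by (simp add: r_def algebra_simps)
      then show "a * s j + b * s' j = ext r yc vc j"
        by (auto simp: 1(1) 2(1) ext_def slack_def J_def r_def)
    qed
    ultimately show "((\<lambda>j. a * s j + b * s' j), a * p + b * p') \<in> S"
      using C(1) by (auto simp: S_def)
  next
    fix s p assume "(s, p) \<in> S" and nonneg: "\<forall>j\<in>insert None (Some ` J). 0 \<le> s j"
    then obtain r y' v' where s: "s = ext r y' v'" "p = lp2_cost P y' v' - r * lp2_cost P y v"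
        and dyn': "lp2_dynamics P y' v'" and init': "y' (T1 P) = r \<cdot>\<^sub>v \<xi>"
      by (auto simp: S_def)
    have r: "0 \<le> r" using nonneg by (auto simp: s ext_def slack_def)
    have rows: "lp2_rows P y' v' t $ i \<le> r * hvec P t $ i"
      if "t \<in> {T1 P..<Tend P}" "i < cdim P t" for t i
      using nonneg that by (auto simp: s ext_def slack_def J_def)
    \<comment> \<open>A homogenised feasible point is a positive multiple of a feasible point if \<open>r > 0\<close>, and a
      recession direction, along which the optimal solution can be moved, if \<open>r = 0\<close>.\<close>
    define a b :: real where "a = (if r = 0 then 1 else 0)" and "b = (if r = 0 then 1 else 1 / r)"
    have ab: "a + b * r = 1" "0 < b" "0 \<le> a" using r by (auto simp: a_def b_def)
    define yc vc where "yc = (\<lambda>t. a \<cdot>\<^sub>v y t + b \<cdot>\<^sub>v y' t)" and "vc = (\<lambda>t. a \<cdot>\<^sub>v v t + b \<cdot>\<^sub>v v' t)"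
    note C = lp2_linear_combination[OF wf dyn dyn', where a = a and b = b, folded yc_def vc_def]
    have "yc (T1 P) = (a + b * r) \<cdot>\<^sub>v \<xi>"
      by (intro eq_vecI) (auto simp: yc_def init init' algebra_simps)
    then have "yc (T1 P) = \<xi>" using ab by simp
    moreover have "lp2_rows P yc vc t \<le> hvec P t" if t: "t \<in> {T1 P..<Tend P}" for t
    proof -
      have "lp2_rows P yc vc t $ i \<le> hvec P t $ i" if i: "i < cdim P t" for i
      proof -
        have "lp2_rows P y v t $ i \<le> hvec P t $ i"
          using feas t i well_formed_second_stage(7)[OF wf t]
          by (auto simp: lp2_feasible_iff less_eq_vec_def)
        then have "a * lp2_rows P y v t $ i \<le> a * hvec P t $ i"
          using ab by (intro mult_left_mono)
        moreover have "b * lp2_rows P y' v' t $ i \<le> b * (r * hvec P t $ i)"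
          using ab rows[OF t i] by (intro mult_left_mono) auto
        ultimately have "lp2_rows P yc vc t $ i \<le> (a + b * r) * hvec P t $ i"
          using C(3)[OF t] lp2_rows_carrier[OF wf dyn t] lp2_rows_carrier[OF wf dyn' t] i
          by (simp add: algebra_simps)
        then show ?thesis using ab by simp
      qed
      then show ?thesis
        using lp2_rows_carrier[OF wf C(1) t] well_formed_second_stage(7)[OF wf t]
        by (auto simp: less_eq_vec_def)
    qed
    ultimately have "lp2_feasible P \<xi> yc vc"
      using C(1) by (simp add: lp2_feasible_iff)
    from best[OF this] have "lp2_cost P y v \<le> a * lp2_cost P y v + b * lp2_cost P y' v'"
      by (simp add: C(2))
    moreover have "lp2_cost P y v = (a + b * r) * lp2_cost P y v" using ab by simp
    ultimately have "0 \<le> b * p"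
      by (simp add: s algebra_simps)
    with ab show "0 \<le> p" by (simp add: zero_le_mult_iff)
  qed
  then obtain w where w: "\<And>j. j \<in> insert None (Some ` J) \<Longrightarrow> 0 \<le> w j"
    and eq: "\<And>s p. (s, p) \<in> S \<Longrightarrow> p = (\<Sum>j\<in>insert None (Some ` J). w j * s j)"
    by blast
  define nu where "nu t = vec (cdim P t) (\<lambda>i. w (Some (t, i)))" for t
  show ?thesis
  proof (rule that)
    show "nu t \<in> carrier_vec (cdim P t)" for t by (simp add: nu_def)
    show "0\<^sub>v (cdim P t) \<le> nu t" if "t \<in> {T1 P..<Tend P}" for t
      using w that by (auto simp: nu_def less_eq_vec_def J_def)
    show "0 \<le> w None" using w by simp
  next
    fix r y' v' assume dyn': "lp2_dynamics P y' v'" and init': "y' (T1 P) = r \<cdot>\<^sub>v \<xi>"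
    then have "(ext r y' v', lp2_cost P y' v' - r * lp2_cost P y v) \<in> S"
      by (auto simp: S_def)
    from eq[OF this]
    have "lp2_cost P y' v' - r * lp2_cost P y v
        = (\<Sum>j\<in>insert None (Some ` J). w j * slack r y' v' j)"
      by (auto simp: ext_def intro!: sum.cong)
    also have "\<dots> = w None * r + (\<Sum>(t, i)\<in>J. w (Some (t, i)) * (r * hvec P t $ i - lp2_rows P y' v' t $ i))"
      using finJ by (subst sum.insert) (auto simp: sum.reindex slack_def case_prod_unfold)
    also have "(\<Sum>(t, i)\<in>J. w (Some (t, i)) * (r * hvec P t $ i - lp2_rows P y' v' t $ i))
        = (\<Sum>t\<in>{T1 P..<Tend P}. \<Sum>i\<in>{0..<cdim P t}.
            w (Some (t, i)) * (r * hvec P t $ i - lp2_rows P y' v' t $ i))"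
      by (simp add: J_def sum.Sigma)
    also have "\<dots> = (\<Sum>t\<in>{T1 P..<Tend P}. nu t \<bullet> (r \<cdot>\<^sub>v hvec P t - lp2_rows P y' v' t))"
    proof (rule sum.cong[OF refl])
      fix t assume "t \<in> {T1 P..<Tend P}"
      from lp2_rows_carrier[OF wf dyn' this] well_formed_second_stage(7)[OF wf this]
      show "(\<Sum>i\<in>{0..<cdim P t}. w (Some (t, i)) * (r * hvec P t $ i - lp2_rows P y' v' t $ i))
          = nu t \<bullet> (r \<cdot>\<^sub>v hvec P t - lp2_rows P y' v' t)"
        by (simp add: scalar_prod_def nu_def)
    qed
    finally show "lp2_cost P y' v' - r * lp2_cost P y v
        = (\<Sum>t\<in>{T1 P..<Tend P}. nu t \<bullet> (r \<cdot>\<^sub>v hvec P t - lp2_rows P y' v' t)) + w None * r"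
      by simp
  qed
qed

text \<open>
  The gradient of the Lagrangian with respect to the inputs is a possible choice of inputs. Applied to
  the trajectory from the origin that it generates, the multiplier identity states that its sum of
  squares is zero. So the multipliers are dual feasible, and their value is at least the primal
  optimum.
\<close>
lemma strong_duality:
  assumes wf: "well_formed P" and opt: "lp2_optimal P \<xi> y v" and dual: "dual_optimal P \<xi> lam nu"
  shows "dual_value P \<xi> lam nu = lp2_cost P y v"
proof -
  have feas: "lp2_feasible P \<xi> y v" and dyn: "lp2_dynamics P y v" and init: "y (T1 P) = \<xi>"
    using opt by (auto simp: lp2_optimal_def lp2_feasible_iff)
  have T: "T1 P < Tend P" using wf by (simp add: well_formed_def)
  have \<xi>: "\<xi> \<in> carrier_vec (xdim P (T1 P))"
    using dyn init T by (auto simp: lp2_dynamics_def)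
  obtain nu' \<mu> where nu': "\<And>t. nu' t \<in> carrier_vec (cdim P t)"
      "\<And>t. t \<in> {T1 P..<Tend P} \<Longrightarrow> 0\<^sub>v (cdim P t) \<le> nu' t" and \<mu>: "0 \<le> \<mu>"
    and lagr: "\<And>r y' v'. lp2_dynamics P y' v' \<Longrightarrow> y' (T1 P) = r \<cdot>\<^sub>v \<xi> \<Longrightarrow>
      lp2_cost P y' v' - r * lp2_cost P y v
        = (\<Sum>t\<in>{T1 P..<Tend P}. nu' t \<bullet> (r \<cdot>\<^sub>v hvec P t - lp2_rows P y' v' t)) + \<mu> * r"
    using lagrange_multipliers_exist[OF wf opt] by blast
  have split: "nu' t \<bullet> (r \<cdot>\<^sub>v hvec P t - lp2_rows P y' v' t)
      = r * (nu' t \<bullet> hvec P t) - nu' t \<bullet> lp2_rows P y' v' t"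
    if "lp2_dynamics P y' v'" "t \<in> {T1 P..<Tend P}" for r y' v' t
    using nu'(1)[of t] lp2_rows_carrier[OF wf that] well_formed_second_stage(7)[OF wf that(2)]
    by (simp add: scalar_prod_minus_distrib[of _ "cdim P t"])
  obtain lam' where co: "costate P lam' nu'"
    using costate_exists[OF wf nu'(1)] by blast
  let ?g = "input_gradient P lam' nu'"
  have g: "?g t \<in> carrier_vec (udim P t)" if t: "t \<in> {T1 P..<Tend P}" for t
    using well_formed_second_stage[OF wf t] by (intro carrier_vecI) (simp add: input_gradient_def)
  obtain z where z: "lp2_dynamics P z ?g" "z (T1 P) = 0\<^sub>v (xdim P (T1 P))"
    using trajectory_exists[OF wf g, of "0\<^sub>v (xdim P (T1 P))"] by auto
  have "z (T1 P) = 0 \<cdot>\<^sub>v \<xi>" using z(2) \<xi> by (intro eq_vecI) auto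
  from lagr[OF z(1) this]
  have "lp2_cost P z ?g + (\<Sum>t\<in>{T1 P..<Tend P}. nu' t \<bullet> lp2_rows P z ?g t) = 0"
    using split[OF z(1)] by (simp add: sum_negf)
  moreover have "cut_slope P lam' nu' \<in> carrier_vec (xdim P (T1 P))"
    using well_formed_second_stage[OF wf, of "T1 P"] T by (intro carrier_vecI) (simp add: cut_slope_def)
  ultimately have "(\<Sum>t\<in>{T1 P..<Tend P}. ?g t \<bullet> ?g t) = 0"
    using lagrangian_identity[OF wf z(1) co] z(2) by simp
  moreover have nonneg: "0 \<le> ?g t \<bullet> ?g t" for t
    by (simp add: scalar_prod_def sum_nonneg)
  ultimately have "?g t \<bullet> ?g t = 0" if "t \<in> {T1 P..<Tend P}" for t
    using that by (subst (asm) sum_nonneg_eq_0_iff) auto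
  then have g0: "?g t = 0\<^sub>v (udim P t)" if t: "t \<in> {T1 P..<Tend P}" for t
    using t g[OF t] by (auto simp: scalar_prod_def sum_nonneg_eq_0_iff)
  have feas': "dual_feasible P lam' nu'"
    using co nu' g0 by (simp add: dual_feasible_iff)
  have "?g t \<bullet> v t = 0" if "t \<in> {T1 P..<Tend P}" for t
    using g0[OF that] lp2_dynamicsD(3)[OF dyn that] by simp
  then have "dual_value P \<xi> lam' nu' = lp2_cost P y v + \<mu>"
    using lagr[OF dyn, of 1] split[OF dyn, of _ 1] lagrangian_identity[OF wf dyn co] init
    by (simp add: dual_value_def sum_subtractf)
  then have "lp2_cost P y v \<le> dual_value P \<xi> lam nu"
    using dual feas' \<mu> by (force simp: dual_optimal_def)
  moreover have "dual_value P \<xi> lam nu \<le> lp2_cost P y v"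
    using weak_duality[OF wf _ feas] dual by (simp add: dual_optimal_def)
  ultimately show ?thesis by simp
qed


section \<open>Cuts\<close>

lemma cuts_eq:
  "cuts P lam nu k = (\<lambda>i. (cut_slope P (lam i) (nu i), cut_offset P (nu i))) ` {..<k}"
  by (induction k) (auto simp: lessThan_Suc)

text \<open>The offset does not depend on \<open>\<xi>\<close>, so a cut is the dual objective as a function of \<open>\<xi>\<close>.\<close>
lemma lower_approx_cuts:
  "lower_approx (cuts P lam nu k) \<xi> = Max ((\<lambda>i. dual_value P \<xi> (lam i) (nu i)) ` {..<k})"
  by (simp add: lower_approx_def cuts_eq image_image cut_offset_def dual_value_def)

lemma lower_approx_le_cost:
  assumes "well_formed P" "\<And>i. i < k \<Longrightarrow> dual_feasible P (lam i) (nu i)" "0 < k"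
    and "lp2_feasible P \<xi> y v"
  shows "lower_approx (cuts P lam nu k) \<xi> \<le> lp2_cost P y v"
  unfolding lower_approx_cuts using assms weak_duality[OF assms(1) _ assms(4)]
  by (subst Max_le_iff) auto

lemma reached_earlier: "reached P x y v lam nu k \<Longrightarrow> i \<le> k \<Longrightarrow> reached P x y v lam nu i"
  by (auto simp: reached_def)

lemma split_horizon_terminates:
  assumes wf: "well_formed P"
    and step2: "\<And>k. reached P x y v lam nu k \<Longrightarrow>
      lp2_optimal P (x k (T1 P)) (y k) (v k) \<and> dual_optimal P (x k (T1 P)) (lam k) (nu k)"
  shows "\<exists>k. stop_test P x y v lam nu k"
proof (rule ccontr)
  assume never: "\<nexists>k. stop_test P x y v lam nu k"
  then have opt: "lp2_optimal P (x k (T1 P)) (y k) (v k)" "dual_optimal P (x k (T1 P)) (lam k) (nu k)"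
    for k using step2 by (auto simp: reached_def)
  then have dual: "dual_feasible P (lam k) (nu k)"
    and primal: "lp2_feasible P (x k (T1 P)) (y k) (v k)" for k
    by (auto simp: dual_optimal_def lp2_optimal_def)
  have "\<not> inj (\<lambda>k. dual_support P (nu k))"
    using finite_dual_supports[of P nu] finite_imageD infinite_UNIV_nat by blast
  then obtain i j where ij: "i < j" "dual_support P (nu i) = dual_support P (nu j)"
    by (metis injI linorder_neqE_nat)
  then obtain m where m: "j = Suc m" by (cases j) auto
  have "dual_value P (x j (T1 P)) (lam i) (nu i) = lp2_cost P (y j) (v j)"
    using support_subset_imp_tight[OF wf dual primal strong_duality[OF wf opt] dual] ij(2) by blast
  then have "lp2_cost P (y j) (v j) \<le> lower_approx (cuts P lam nu j) (x j (T1 P))"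
    unfolding lower_approx_cuts using ij(1) by (intro Max_ge) (auto intro!: image_eqI[of _ _ i])
  moreover have "lower_approx (cuts P lam nu j) (x j (T1 P)) \<le> lp2_cost P (y j) (v j)"
    using lower_approx_le_cost[OF wf _ _ primal] dual ij(1) by auto
  ultimately have "stop_test P x y v lam nu j"
    by (simp add: stop_test_def UB_def m)
  with never show False by blast
qed

theorem theorem1:
  fixes P :: split_problem
    and x u y v lam nu :: "nat \<Rightarrow> nat \<Rightarrow> real vec"
  assumes "well_formed P"
    and TS_feasible: "\<exists>x' u' y' v'. ts_feasible P x' u' y' v'"
    and LP2_feasible:
      "\<And>x' u'. first_feasible P x' u' \<Longrightarrow> \<exists>y' v'. lp2_feasible P (x' (T1 P)) y' v'"
    and step1: "first_feasible P (x 0) (u 0)"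
    and step2: "\<And>k. reached P x y v lam nu k \<Longrightarrow>
      lp2_optimal P (x k (T1 P)) (y k) (v k) \<and> dual_optimal P (x k (T1 P)) (lam k) (nu k)"
    and step6: "\<And>k. reached P x y v lam nu (Suc k) \<Longrightarrow> first_feasible P (x (Suc k)) (u (Suc k))"
  shows "\<exists>N. reached P x y v lam nu N \<and> stop_test P x y v lam nu N \<and>
    ts_feasible P (x N) (u N) (y N) (v N) \<and>
    ((\<forall>k<N. nlp1_local_opt P (lower_approx (cuts P lam nu (Suc k))) (x (Suc k)) (u (Suc k)))
       \<longrightarrow> ts_local_opt P (x N) (u N) (y N) (v N)) \<and>
    ((\<forall>k<N. nlp1_global_opt P (lower_approx (cuts P lam nu (Suc k))) (x (Suc k)) (u (Suc k)))
       \<longrightarrow> ts_global_opt P (x N) (u N) (y N) (v N))"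
proof -
  define N where "N = (LEAST k. stop_test P x y v lam nu k)"
  have stop: "stop_test P x y v lam nu N"
    using split_horizon_terminates[of P x y v lam nu] assms(1) step2 unfolding N_def by (metis LeastI_ex)
  have reach: "reached P x y v lam nu N"
    using not_less_Least by (auto simp: reached_def N_def)
  \<comment> \<open>In iteration 0 the lower bound is \<open>-\<infinity>\<close>, which no cost equals.\<close>
  obtain m where m: "N = Suc m"
    using stop by (cases N) (auto simp: stop_test_def UB_def)
  have ts: "ts_feasible P (x N) (u N) (y N) (v N)"
    using step6[of m] step2[OF reach] reach by (simp add: m ts_feasible_def lp2_optimal_def)
  let ?G = "lower_approx (cuts P lam nu N)"
  have tight: "?G (x N (T1 P)) = lp2_cost P (y N) (v N)"
    using stop by (simp add: stop_test_def UB_def m)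
  have dual: "dual_feasible P (lam i) (nu i)" if "i < N" for i
    using step2[OF reached_earlier[OF reach, of i]] that by (simp add: dual_optimal_def)
  have below: "first_cost P x' u' + ?G (x' (T1 P)) \<le> ts_cost P x' u' y' v'"
    if "ts_feasible P x' u' y' v'" for x' u' y' v'
    using lower_approx_le_cost[OF assms(1), of N lam nu "x' (T1 P)" y' v'] dual that
    by (simp add: m ts_feasible_def ts_cost_def del: cuts.simps)
  have cost: "ts_cost P (x N) (u N) (y N) (v N) = first_cost P (x N) (u N) + ?G (x N (T1 P))"
    by (simp add: ts_cost_def tight)
  have "ts_local_opt P (x N) (u N) (y N) (v N)" if "nlp1_local_opt P ?G (x N) (u N)"
  proof -
    from that obtain \<epsilon> where "0 < \<epsilon>" and \<epsilon>: "\<And>x' u'. first_feasible P x' u' \<Longrightarrow>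
        first_near P \<epsilon> (x N) (u N) x' u' \<Longrightarrow>
        first_cost P (x N) (u N) + ?G (x N (T1 P)) \<le> first_cost P x' u' + ?G (x' (T1 P))"
      by (auto simp: nlp1_local_opt_def)
    have "ts_cost P (x N) (u N) (y N) (v N) \<le> ts_cost P x' u' y' v'"
      if "ts_feasible P x' u' y' v'" "first_near P \<epsilon> (x N) (u N) x' u'" for x' u' y' v'
      using \<epsilon>[OF _ that(2)] below[OF that(1)] that(1) by (force simp: cost ts_feasible_def)
    with ts \<open>0 < \<epsilon>\<close> show ?thesis unfolding ts_local_opt_def by blast
  qed
  moreover have "ts_global_opt P (x N) (u N) (y N) (v N)" if "nlp1_global_opt P ?G (x N) (u N)"
    using that ts below by (force simp: ts_global_opt_def nlp1_global_opt_def cost ts_feasible_def)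
  ultimately show ?thesis
    using reach stop ts m by blast
qed

end
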